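(* For every integer $k \geq 3$, there are infinitely many $k$-dicritical digraphs that contain no directed path on $3k+1$ vertices.
   Context: Digraphs are finite, without loops or parallel arcs (two opposite arcs $uv, vu$, forming a digon, are allowed). A $k$-dicolouring of a digraph $D$ is a map $V(D)\to\{1,\dots,k\}$ such that every colour class induces an acyclic subdigraph (i.e. no directed cycle is monochromatic). The dichromatic number $\vec{\chi}(D)$ is the least $k$ such that $D$ has a $k$-dicolouring. A digraph $D$ is $k$-dicritical if $\vec{\chi}(D)=k$ and every proper subdigraph $H$ of $D$ satisfies $\vec{\chi}(H)<k$. A directed path on $n$ vertices is a subdigraph with vertices $u_1,\dots,u_n$ and arcs $u_iu_{i+1}$, $1\le i<n$. *)

theory Defs
  imports "Graph_Theory.Graph_Theory"
begin

text \<open>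
  In the library, \<^const>\<open>pre_digraph.cycle\<close> means a simple nonempty closed directed walk, so a
  digon is a cycle. The library predicate \<^locale>\<open>digraph\<close> stands for finite digraphs without
  loops and without parallel arcs, digons being allowed.
\<close>

definition acyclic_digraph :: "('a, 'b) pre_digraph \<Rightarrow> bool" where
  "acyclic_digraph G \<longleftrightarrow> \<not> (\<exists>p. pre_digraph.cycle G p)"

definition dicolouring :: "('a, 'b) pre_digraph \<Rightarrow> nat \<Rightarrow> ('a \<Rightarrow> nat) \<Rightarrow> bool" where
  "dicolouring G k c \<longleftrightarrow>
     c \<in> verts G \<rightarrow> {1..k} \<and>
     (\<forall>i\<in>{1..k}. acyclic_digraph (G \<restriction> {v \<in> verts G. c v = i}))"

text \<open>
  The minimum exists for every digraph, see \<open>dicolouring_exists\<close> below. The null digraph has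
  dichromatic number 0.
\<close>

definition dichromatic_number :: "('a, 'b) pre_digraph \<Rightarrow> nat" where
  "dichromatic_number G = (LEAST k. \<exists>c. dicolouring G k c)"

text \<open>
  \<^const>\<open>subgraph\<close> requires both digraphs to have the same tail and head functions, so
  \<open>H \<noteq> G\<close> below means that a vertex or an arc of \<open>G\<close> is missing in \<open>H\<close>.
\<close>

definition dicritical :: "nat \<Rightarrow> ('a, 'b) pre_digraph \<Rightarrow> bool" where
  "dicritical k G \<longleftrightarrow>
     digraph G \<and> dichromatic_number G = k \<and>
     (\<forall>H. subgraph H G \<and> H \<noteq> G \<longrightarrow> dichromatic_number H < k)"

lemma dicolouring_exists:
  assumes "digraph G"
  shows "\<exists>k c. dicolouring G k c"
proof -
  interpret digraph G by fact
  obtain f :: "'a \<Rightarrow> nat" where f: "inj_on f (verts G)"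
    using finite_verts finite_imp_inj_to_nat_seg by blast
  define c where "c v = Suc (f v)" for v
  define k where "k = Max (insert 0 (c ` verts G))"
  have rng: "c \<in> verts G \<rightarrow> {1..k}"
    by (auto simp: k_def c_def intro: Max_ge)
  have "acyclic_digraph (G \<restriction> {v \<in> verts G. c v = i})" for i
  proof -
    let ?H = "G \<restriction> {v \<in> verts G. c v = i}"
    have no_arcs: "arcs ?H = {}"
    proof (rule equals0I)
      fix e assume "e \<in> arcs ?H"
      then have e: "e \<in> arcs G" and "c (tail G e) = c (head G e)" by auto
      then have "tail G e = head G e"
        using f by (auto simp: c_def dest: inj_onD)
      then show False using no_loops[OF e] by simp
    qed
    have "\<not> pre_digraph.cycle ?H p" for p
      unfolding pre_digraph.cycle_def pre_digraph.awalk_def no_arcs by simp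
    then show ?thesis by (simp add: acyclic_digraph_def)
  qed
  with rng show ?thesis unfolding dicolouring_def by blast
qed

lemma digraph_iso_with_proj_iff:
  assumes "pair_wf_digraph G"
  shows "digraph_iso (with_proj G) (with_proj H) \<longleftrightarrow>
    (\<exists>f. bij_betw f (pverts G) (pverts H) \<and> parcs H = (\<lambda>(u, v). (f u, f v)) ` parcs G)"
    (is "?L \<longleftrightarrow> ?R")
proof
  interpret pair_wf_digraph G by fact
  assume ?L
  then obtain h where h: "pre_digraph.digraph_isomorphism (with_proj G) h"
    and H: "with_proj H = app_iso h (with_proj G)"
    unfolding digraph_iso_def by blast
  from H have V: "pverts H = iso_verts h ` pverts G" and A: "parcs H = iso_arcs h ` parcs G"
    and t: "iso_tail h = fst" and hd: "iso_head h = snd"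
    by (auto simp: app_iso_def with_proj_def)
  have arc: "iso_arcs h e = (iso_verts h (fst e), iso_verts h (snd e))" if "e \<in> parcs G" for e
    using h that unfolding pre_digraph.digraph_isomorphism_def
    by (auto simp: t hd prod_eq_iff)
  have "bij_betw (iso_verts h) (pverts G) (pverts H)"
    using h V unfolding pre_digraph.digraph_isomorphism_def bij_betw_def by auto
  moreover have "parcs H = (\<lambda>(u, v). (iso_verts h u, iso_verts h v)) ` parcs G"
    unfolding A by (intro image_cong) (auto simp: arc)
  ultimately show ?R by blast
next
  interpret pair_wf_digraph G by fact
  assume ?R
  then obtain f where f: "bij_betw f (pverts G) (pverts H)"
    and A: "parcs H = (\<lambda>(u, v). (f u, f v)) ` parcs G" by blast
  let ?h = "\<lparr> iso_verts = f, iso_arcs = (\<lambda>(u, v). (f u, f v)), iso_head = snd, iso_tail = fst \<rparr>"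
  have "inj_on f (pverts G)" using f by (simp add: bij_betw_def)
  then have "inj_on (\<lambda>(u, v). (f u, f v)) (parcs G)"
    by (auto simp: inj_on_def dest: in_arcsD1 in_arcsD2)
  then have "pre_digraph.digraph_isomorphism (with_proj G) ?h"
    using \<open>inj_on f (pverts G)\<close> wf_digraph
    unfolding pre_digraph.digraph_isomorphism_def by (auto simp: case_prod_beta)
  moreover have "with_proj H = app_iso ?h (with_proj G)"
    using f A by (simp add: app_iso_def with_proj_def bij_betw_def)
  ultimately show ?L unfolding digraph_iso_def by blast
qed

end

theory Submission
  imports Defs
begin

text \<open>
  Join an antidirected path with an even number of vertices to \<open>k - 1\<close> pairwise adjacent hubs in such
  a way that a \<open>(k - 1)\<close>-dicolouring would have to alternate between two colours along the path,
  while both ends are denied the same one of these two colours. The parity obstruction disappears as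
  soon as any path vertex is deleted, so every \<open>k\<close>-dicritical subdigraph contains the whole path and
  is therefore large. A directed path has at most two vertices between consecutive hubs, hence at
  most \<open>(k - 1) + 2 * k = 3 * k - 1\<close> vertices.
\<close>

section \<open>Dicolourings and dicritical subdigraphs\<close>

text \<open>Every arc raises the rank by at least one, so a walk with \<open>l\<close> arcs raises
  it by at least \<open>l\<close>; a nonempty closed walk is impossible.\<close>

lemma acyclic_digraph_rankI:
  fixes f :: "'a \<Rightarrow> nat"
  assumes "\<And>e. e \<in> arcs G \<Longrightarrow> f (tail G e) < f (head G e)"
  shows "acyclic_digraph G"
proof -
  have rank: "f u + length p \<le> f v" if "pre_digraph.cas G u p v" "set p \<subseteq> arcs G" for u p v
    using that
  proof (induction p arbitrary: u)
    case Nil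
    then show ?case by (simp add: pre_digraph.cas.simps)
  next
    case (Cons e p)
    then have "f (head G e) + length p \<le> f v" "tail G e = u"
      by (auto simp: pre_digraph.cas.simps)
    with assms[of e] Cons.prems show ?case by auto
  qed
  show ?thesis
    unfolding acyclic_digraph_def pre_digraph.cycle_def pre_digraph.awalk_def
    using rank by fastforce
qed

text \<open>Only monochromatic arcs have to increase, and each colour may use its own rank
  \<open>f i\<close>.\<close>

lemma dicolouring_rankI:
  fixes f :: "nat \<Rightarrow> 'a \<Rightarrow> nat"
  assumes "\<And>v. v \<in> verts G \<Longrightarrow> c v \<in> {1..k}"
    and "\<And>e i. e \<in> arcs G \<Longrightarrow> c (tail G e) = i \<Longrightarrow> c (head G e) = i \<Longrightarrow>
      f i (tail G e) < f i (head G e)"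
  shows "dicolouring G k c"
  unfolding dicolouring_def
proof (intro conjI ballI)
  show "c \<in> verts G \<rightarrow> {1..k}" using assms(1) by blast
next
  fix i
  show "acyclic_digraph (G \<restriction> {v \<in> verts G. c v = i})"
    by (rule acyclic_digraph_rankI[of _ "f i"]) (use assms(2) in auto)
qed

lemma dicolouring_not_constant_on_cycle:
  assumes "dicolouring G k c" "pre_digraph.cycle G p"
    and "\<And>e. e \<in> set p \<Longrightarrow>
      tail G e \<in> verts G \<and> head G e \<in> verts G \<and> c (tail G e) = i \<and> c (head G e) = i"
  shows False
proof -
  let ?H = "G \<restriction> {v \<in> verts G. c v = i}"
  obtain u where u: "u \<in> verts G" "set p \<subseteq> arcs G" "pre_digraph.cas G u p u"
    "distinct (tl (pre_digraph.awalk_verts G u p))" "p \<noteq> []"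
    using assms(2) unfolding pre_digraph.cycle_def pre_digraph.awalk_def by blast
  \<comment> \<open>The base vertex is the tail of the first arc, so it has colour \<open>i\<close>
    too; this puts it in the colour class and \<open>i\<close> in the range of colours.\<close>
  from u(3,5) have "tail G (hd p) = u"
    by (cases p) (auto simp: pre_digraph.cas.simps)
  with u(5) assms(3) have "c u = i" by (metis list.set_sel(1))
  with u assms(3) have "pre_digraph.cycle ?H p"
    unfolding pre_digraph.cycle_def pre_digraph.awalk_def
    by (auto simp: compatible_cas[OF compatible_induce_subgraph]
        compatible_awalk_verts[OF compatible_induce_subgraph] intro!: exI[of _ u])
  moreover have "i \<in> {1..k}"
    using assms(1) u(1) \<open>c u = i\<close> unfolding dicolouring_def by blast
  ultimately show False
    using assms(1) unfolding dicolouring_def acyclic_digraph_def by blast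
qed

lemma dicolouring_subgraph:
  assumes "subgraph H G" "dicolouring G k c"
  shows "dicolouring H k c"
proof -
  from assms(1) have H: "verts H \<subseteq> verts G" "wf_digraph G" "wf_digraph H" by auto
  have "acyclic_digraph (H \<restriction> {v \<in> verts H. c v = i})" if "i \<in> {1..k}" for i
  proof -
    have "subgraph (H \<restriction> {v \<in> verts H. c v = i}) (G \<restriction> {v \<in> verts G. c v = i})"
      using assms(1) wf_digraph.wellformed_induce_subgraph[OF H(2)]
        wf_digraph.wellformed_induce_subgraph[OF H(3)]
      by (auto simp: subgraph_def compatible_def)
    from wf_digraph.subgraph_cycle[OF wf_digraph.wellformed_induce_subgraph[OF H(2)] this]
    show ?thesis
      using assms(2) that unfolding dicolouring_def acyclic_digraph_def by blast
  qed
  then show ?thesis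
    using assms(2) H(1) unfolding dicolouring_def by blast
qed

lemma dichromatic_number_le: "dicolouring G k c \<Longrightarrow> dichromatic_number G \<le> k"
  unfolding dichromatic_number_def by (rule Least_le) blast

lemma dicolouring_dichromatic_number:
  assumes "digraph G"
  shows "\<exists>c. dicolouring G (dichromatic_number G) c"
  unfolding dichromatic_number_def by (rule LeastI_ex) (rule dicolouring_exists[OF assms])

lemma dichromatic_number_mono:
  assumes "digraph G" "subgraph H G"
  shows "dichromatic_number H \<le> dichromatic_number G"
  using dicolouring_dichromatic_number[OF assms(1)] dicolouring_subgraph[OF assms(2)]
    dichromatic_number_le by blast

lemma subgraph_size_less:
  assumes "digraph G" "subgraph H G" "H \<noteq> G"
  shows "card (verts H) + card (arcs H) < card (verts G) + card (arcs G)"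
proof -
  interpret digraph G by fact
  have sub: "verts H \<subseteq> verts G" "arcs H \<subseteq> arcs G" and
    eq: "tail H = tail G" "head H = head G"
    using assms(2) by (auto simp: subgraph_def compatible_def)
  have "verts H \<noteq> verts G \<or> arcs H \<noteq> arcs G"
    using assms(3) eq by (auto intro: pre_digraph.equality)
  then show ?thesis
    using sub psubset_card_mono[OF finite_verts, of "verts H"]
      psubset_card_mono[OF finite_arcs, of "arcs H"]
      card_mono[OF finite_verts sub(1)] card_mono[OF finite_arcs sub(2)]
    by (meson add_le_less_mono add_less_le_mono psubsetI)
qed

text \<open>Take a subgraph of least size among those whose dichromatic number is not below that of
  \<open>G\<close>. Monotonicity turns the bound into equality, and minimality makes every proper
  subgraph drop below it.\<close>

lemma dicritical_subgraph_exists: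
  assumes "digraph G"
  shows "\<exists>H. subgraph H G \<and> dicritical (dichromatic_number G) H"
proof -
  interpret digraph G by fact
  let ?P = "\<lambda>H. subgraph H G \<and> dichromatic_number G \<le> dichromatic_number H"
  let ?size = "\<lambda>H. card (verts H) + card (arcs H)"
  have "?P G" by (simp add: subgraph_refl)
  then obtain H where H: "?P H" and least: "\<And>H'. ?P H' \<Longrightarrow> ?size H \<le> ?size H'"
    using ex_has_least_nat[of ?P G ?size] by blast
  have dH: "digraph H" using H digraph_subgraph by blast
  have "dichromatic_number H' < dichromatic_number G" if "subgraph H' H" "H' \<noteq> H" for H'
    using subgraph_size_less[OF dH that] least[of H'] subgraph_trans[OF that(1)] H
    by (meson not_le)
  moreover have "dichromatic_number H = dichromatic_number G"
    using H dichromatic_number_mono[OF assms] by (simp add: le_antisym)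
  ultimately show ?thesis
    using H dH unfolding dicritical_def by blast
qed

section \<open>An antidirected path with hubs\<close>

text \<open>
  The vertices below \<open>n\<close> form an antidirected path, with even vertices as sources and odd ones as
  sinks. The vertices \<open>n, \<dots>, n + s - 1\<close> are the hubs. The hubs from \<open>n + 2\<close> on exclude their
  colours from the path; hubs \<open>n\<close> and \<open>n + 1\<close> form a directed triangle with each arc of the path;
  and hub \<open>n + 1\<close> excludes its colour from both ends of the path.
\<close>

definition hub_arc :: "nat \<Rightarrow> nat \<Rightarrow> nat \<Rightarrow> bool" where
  "hub_arc n u v \<longleftrightarrow> u \<noteq> v \<and>
     (n \<le> u \<and> n \<le> v \<or> u < n \<and> n + 2 \<le> v \<or> n + 2 \<le> u \<and> v < n \<or>
      u < n \<and> v < n \<and> even u \<and> (v = Suc u \<or> u = Suc v) \<or>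
      (u = n \<or> u = Suc n) \<and> v < n \<and> even v \<or>
      (v = n \<or> v = Suc n) \<and> u < n \<and> odd u \<or>
      u = 0 \<and> v = Suc n \<or> u = Suc n \<and> Suc v = n)"

definition hub_digraph :: "nat \<Rightarrow> nat \<Rightarrow> nat pair_pre_digraph" where
  "hub_digraph s n =
     \<lparr> pverts = {..<n + s}, parcs = {(u, v). u < n + s \<and> v < n + s \<and> hub_arc n u v} \<rparr>"

lemma hub_digraph_simps [simp]:
  "pverts (hub_digraph s n) = {..<n + s}"
  "(u, v) \<in> parcs (hub_digraph s n) \<longleftrightarrow> u < n + s \<and> v < n + s \<and> hub_arc n u v"
  by (auto simp: hub_digraph_def)

lemma digraph_hub_digraph: "digraph (with_proj (hub_digraph s n))"
proof -
  have "parcs (hub_digraph s n) \<subseteq> {..<n + s} \<times> {..<n + s}" by auto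
  then have "finite (parcs (hub_digraph s n))"
    by (rule finite_subset) simp
  then interpret pair_digraph "hub_digraph s n"
    by unfold_locales (auto simp: hub_arc_def)
  show ?thesis ..
qed

section \<open>Dicolourings of hub digraphs and of their subgraphs\<close>

lemma hub_digraph_subgraph_dicolouring:
  assumes "2 \<le> s" "even n" "subgraph H (with_proj (hub_digraph s n))"
    and "w < n" "w \<notin> verts H"
  shows "\<exists>c. dicolouring H s c"
proof -
  \<comment> \<open>Colours 1 and 2 alternate along the path and the pattern flips at the missing
    \<open>w\<close>, so both ends can get colour 1, which differs from the colour 2 of hub
    \<open>Suc n\<close>.\<close>
  define c :: "nat \<Rightarrow> nat" where "c v =
    (if n \<le> v then Suc (v - n) else if even v \<longleftrightarrow> v < w then 1 else 2)" for v
  \<comment> \<open>Monochromatic arcs only lead from odd path vertices to hubs and from hubs to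
    even path vertices.\<close>
  define f :: "nat \<Rightarrow> nat" where "f v = (if n \<le> v then 1 else if even v then 2 else 0)" for v
  have H: "verts H \<subseteq> {..<n + s}" "arcs H \<subseteq> parcs (hub_digraph s n)"
    "wf_digraph H" "tail H = fst" "head H = snd"
    using assms(3) by (auto simp: subgraph_def compatible_def)
  have rank: "f u < f v" if "hub_arc n u v" "c u = c v" "u \<noteq> w" "v \<noteq> w" for u v
  proof -
    consider "n \<le> u" "n \<le> v" | "u < n" "n \<le> v" | "n \<le> u" "v < n" | "u < n" "v < n"
      by linarith
    then show ?thesis
    proof cases
      case 1
      with that(1,2) show ?thesis by (simp add: hub_arc_def c_def)
    next
      case 2
      then have "v = n \<or> v = Suc n" using that(2) by (auto simp: c_def split: if_splits)
      moreover have "odd u"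
      proof
        \<comment> \<open>The only such arc belongs to the digon at the end 0, where
          \<open>0 < w\<close> gives colour 1 against 2. The other end is treated alike in case
          3.\<close>
        assume "even u"
        with 2 that(1) \<open>v = n \<or> v = Suc n\<close> have "u = 0" "v = Suc n" by (auto simp: hub_arc_def)
        with that(2,3) 2 assms(4) show False by (simp add: c_def)
      qed
      ultimately show ?thesis using 2 by (simp add: f_def)
    next
      case 3
      then have "u = n \<or> u = Suc n" using that(2) by (auto simp: c_def split: if_splits)
      moreover have "even v"
      proof (rule ccontr)
        assume "odd v"
        with 3 that(1) \<open>u = n \<or> u = Suc n\<close> have "Suc v = n" "u = Suc n" by (auto simp: hub_arc_def)
        with that(2,4) 3 assms(4) \<open>odd v\<close> show False by (auto simp: c_def)
      qed
      ultimately show ?thesis using 3 by (simp add: f_def)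
    next
      case 4
      with that(1) have "even u" "v = Suc u \<or> u = Suc v" by (auto simp: hub_arc_def)
      with that(2-4) 4 show ?thesis by (auto simp: c_def split: if_splits)
    qed
  qed
  have "dicolouring H s c"
  proof (rule dicolouring_rankI)
    show "c v \<in> {1..s}" if "v \<in> verts H" for v
      using that H(1) assms(1) by (auto simp: c_def)
    show "f (tail H e) < f (head H e)"
      if e: "e \<in> arcs H" and i: "c (tail H e) = i" "c (head H e) = i" for e i
    proof -
      obtain u v where uv: "e = (u, v)" by fastforce
      have "u \<in> verts H" "v \<in> verts H"
        using wf_digraph.tail_in_verts[OF H(3) e] wf_digraph.head_in_verts[OF H(3) e] H uv by auto
      then have "u \<noteq> w" "v \<noteq> w" using assms(5) by auto
      moreover have "hub_arc n u v" using e H(2) uv by auto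
      moreover have "c u = c v" using i H uv by auto
      ultimately have "f u < f v" by (intro rank)
      then show ?thesis using H uv by simp
    qed
  qed
  then show ?thesis by blast
qed

text \<open>One extra colour serves the whole path, whose arcs all lead from even to odd
  vertices.\<close>

lemma hub_digraph_dicolouring:
  "\<exists>c. dicolouring (with_proj (hub_digraph s n)) (Suc s) c"
proof -
  define c where "c v = (if n \<le> v then Suc (v - n) else Suc s)" for v
  have rank: "even u \<and> odd v" if "hub_arc n u v" "c u = c v" "u < n + s" "v < n + s" for u v
  proof -
    have "u < n \<longleftrightarrow> v < n" using that(2-4) by (auto simp: c_def split: if_splits)
    with that(1,2) show ?thesis by (cases "u < n") (auto simp: hub_arc_def c_def)
  qed
  have "dicolouring (with_proj (hub_digraph s n)) (Suc s) c"
  proof (rule dicolouring_rankI[where f = "\<lambda>i v. if even v then 0 else 1"])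
    show "c v \<in> {1..Suc s}" if "v \<in> verts (with_proj (hub_digraph s n))" for v
      using that by (auto simp: c_def)
  qed (use rank in fastforce)
  then show ?thesis by blast
qed

section \<open>Lower bound on the dichromatic number\<close>

lemma dicolouring_digon:
  assumes "dicolouring (with_proj D) k c" "pair_wf_digraph D"
    and "(u, v) \<in> parcs D" "(v, u) \<in> parcs D" "u \<noteq> v"
  shows "c u \<noteq> c v"
proof
  interpret pair_wf_digraph D by fact
  assume eq: "c u = c v"
  have "pre_digraph.cycle (with_proj D) [(u, v), (v, u)]"
    unfolding pre_digraph.cycle_def pre_digraph.awalk_def
    using assms(3-5) by (auto simp: in_arcsD1 intro!: exI[of _ u])
  then show False
    by (rule dicolouring_not_constant_on_cycle[OF assms(1), where i = "c u"])
      (use assms(3) eq in \<open>auto simp: in_arcsD1 in_arcsD2\<close>)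
qed

lemma dicolouring_triangle:
  assumes "dicolouring (with_proj D) k c" "pair_wf_digraph D"
    and "(u, v) \<in> parcs D" "(v, w) \<in> parcs D" "(w, u) \<in> parcs D"
    and "u \<noteq> v" "v \<noteq> w" "w \<noteq> u"
  shows "\<not> (c u = c v \<and> c w = c v)"
proof
  interpret pair_wf_digraph D by fact
  assume eq: "c u = c v \<and> c w = c v"
  have "pre_digraph.cycle (with_proj D) [(u, v), (v, w), (w, u)]"
    unfolding pre_digraph.cycle_def pre_digraph.awalk_def
    using assms(3-8) by (auto simp: in_arcsD1 intro!: exI[of _ u])
  then show False
    by (rule dicolouring_not_constant_on_cycle[OF assms(1), where i = "c v"])
      (use assms(3,4) eq in \<open>auto simp: in_arcsD1 in_arcsD2\<close>)
qed

lemma hub_digraph_no_dicolouring: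
  assumes "2 \<le> s" "even n" "0 < n" "k \<le> s"
  shows "\<not> dicolouring (with_proj (hub_digraph s n)) k c"
proof
  let ?D = "hub_digraph s n"
  assume col: "dicolouring (with_proj ?D) k c"
  have wf: "pair_wf_digraph ?D"
    using digraph_hub_digraph[of s n] unfolding wf_digraph_wp_iff[symmetric]
    by (simp add: digraph_def fin_digraph_def)
  have range: "c v \<in> {1..s}" if "v < n + s" for v
  proof -
    have "c \<in> {..<n + s} \<rightarrow> {1..k}" using col unfolding dicolouring_def by simp
    then have "c v \<in> {1..k}" using that by blast
    then show ?thesis using assms(4) by simp
  qed
  have digon: "c u \<noteq> c v" if "hub_arc n u v" "hub_arc n v u" "u < n + s" "v < n + s" for u v
  proof -
    have "u \<noteq> v" using that(1) by (simp add: hub_arc_def)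
    with that show ?thesis by (intro dicolouring_digon[OF col wf]) simp_all
  qed
  \<comment> \<open>The \<open>s\<close> hubs are pairwise joined by digons, so they use up all
    \<open>s\<close> colours, each once.\<close>
  have "inj_on c {n..<n + s}"
  proof (rule inj_onI, rule ccontr)
    fix x y assume "x \<in> {n..<n + s}" "y \<in> {n..<n + s}" "c x = c y" "x \<noteq> y"
    then show False using digon[of x y] by (simp add: hub_arc_def)
  qed
  then have "card (c ` {n..<n + s}) = card {1..s}"
    by (simp add: card_image)
  moreover have "c ` {n..<n + s} \<subseteq> {1..s}" using range by auto
  ultimately have hubs: "c ` {n..<n + s} = {1..s}"
    by (simp add: card_subset_eq)
  \<comment> \<open>The hubs from \<open>n + 2\<close> on form digons with every path vertex, which
    leaves only two colours for the path.\<close>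
  have two: "c v = c n \<or> c v = c (Suc n)" if "v < n" for v
  proof -
    have "c v \<in> c ` {n..<n + s}" using that range[of v] hubs by simp
    then obtain x where x: "n \<le> x" "x < n + s" "c v = c x" by auto
    have "\<not> n + 2 \<le> x"
      using digon[of v x] that x by (auto simp: hub_arc_def)
    with x have "x = n \<or> x = Suc n" by auto
    with x(3) show ?thesis by auto
  qed
  \<comment> \<open>The path arc from \<open>u\<close> to \<open>v\<close> closes to a directed
    triangle through either hub \<open>x\<close>.\<close>
  have arc: "\<not> (c u = c x \<and> c v = c x)"
    if "even u" "u < n" "v < n" "v = Suc u \<or> u = Suc v" "x = n \<or> x = Suc n" for u v x
  proof -
    have "odd v" using that(1,4) by auto
    then have "hub_arc n u v" "hub_arc n v x" "hub_arc n x u" "u \<noteq> v" "v \<noteq> x" "x \<noteq> u"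
      using that by (auto simp: hub_arc_def)
    with dicolouring_triangle[OF col wf, of u v x] that assms(1) show ?thesis by auto
  qed
  have step: "\<not> (c v = c x \<and> c (Suc v) = c x)" if "Suc v < n" "x = n \<or> x = Suc n" for v x
  proof (cases "even v")
    case True
    with arc[of v "Suc v" x] that show ?thesis by simp
  next
    case False
    with arc[of "Suc v" v x] that show ?thesis by auto
  qed
  have ends: "c 0 \<noteq> c (Suc n)" "c (n - 1) \<noteq> c (Suc n)"
  proof -
    have "odd (n - 1)" using assms(2,3) by simp
    then have "hub_arc n 0 (Suc n)" "hub_arc n (Suc n) 0"
      "hub_arc n (n - 1) (Suc n)" "hub_arc n (Suc n) (n - 1)"
      using assms(3) by (auto simp: hub_arc_def)
    with digon[of 0 "Suc n"] digon[of "n - 1" "Suc n"] assms(1)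
    show "c 0 \<noteq> c (Suc n)" "c (n - 1) \<noteq> c (Suc n)" by simp_all
  qed
  \<comment> \<open>The colour of vertex 0 is forced to be \<open>c n\<close>, and the alternation
    then gives the odd end \<open>n - 1\<close> the forbidden colour
    \<open>c (Suc n)\<close>.\<close>
  have "c v = (if even v then c n else c (Suc n))" if "v < n" for v
    using that
  proof (induction v)
    case 0
    then show ?case using two[of 0] ends(1) by simp
  next
    case (Suc v)
    then have "c v = (if even v then c n else c (Suc n))" by simp
    with Suc.prems two[of "Suc v"] step[of v n] step[of v "Suc n"] show ?case
      by (cases "even v") simp_all
  qed
  from this[of "n - 1"] show False using ends(2) assms(2,3) by simp
qed

section \<open>Dichromatic number and lengths of directed paths\<close>

lemma dichromatic_number_hub_digraph:
  assumes "2 \<le> s" "even n" "0 < n"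
  shows "dichromatic_number (with_proj (hub_digraph s n)) = Suc s"
proof (rule antisym)
  show "dichromatic_number (with_proj (hub_digraph s n)) \<le> Suc s"
    using hub_digraph_dicolouring dichromatic_number_le by blast
  show "Suc s \<le> dichromatic_number (with_proj (hub_digraph s n))"
    using dicolouring_dichromatic_number[OF digraph_hub_digraph]
      hub_digraph_no_dicolouring[OF assms] by (metis not_less_eq_eq)
qed

text \<open>Among any three consecutive vertices of a walk there is a hub.\<close>

lemma hub_walk_length:
  assumes "set (vwalk_arcs p) \<subseteq> {(u, v). hub_arc n u v}"
  shows "length p \<le> 3 * length (filter (\<lambda>v. n \<le> v) p) + 2"
  using assms
proof (induction p rule: length_induct)
  case (1 p)
  show ?case
  proof (cases "\<exists>a b d q. p = a # b # d # q")
    case True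
    then obtain a b d q where p: "p = a # b # d # q" by blast
    have "set (vwalk_arcs q) \<subseteq> set (vwalk_arcs p)" unfolding p by (cases q) auto
    with 1(2) have "set (vwalk_arcs q) \<subseteq> {(u, v). hub_arc n u v}" by (rule subset_trans[rotated])
    with 1(1) have "length q \<le> 3 * length (filter (\<lambda>v. n \<le> v) q) + 2"
      unfolding p by simp
    \<comment> \<open>Otherwise \<open>b\<close> would be both a sink and a source of the
      antidirected path.\<close>
    moreover have "n \<le> a \<or> n \<le> b \<or> n \<le> d"
      using 1(2) unfolding p by (auto simp: hub_arc_def)
    ultimately show ?thesis unfolding p by auto
  next
    case False
    then have "length p \<le> 2"
      by (metis (no_types) Suc_1 length_Cons list.exhaust list.size(3) not_less_eq_eq le0 numeral_2_eq_2)
    then show ?thesis by simp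
  qed
qed

text \<open>A path repeats no vertex, so it meets each of the \<open>s\<close> hubs at most
  once.\<close>

lemma hub_digraph_vpath_length:
  assumes "vpath p (with_proj D)" "pverts D \<subseteq> {..<n + s}" "parcs D \<subseteq> parcs (hub_digraph s n)"
  shows "length p \<le> 3 * s + 2"
proof -
  have p: "set p \<subseteq> {..<n + s}" "set (vwalk_arcs p) \<subseteq> {(u, v). hub_arc n u v}" "distinct p"
    using assms by (auto simp: vpath_def vwalk_def)
  have "length (filter (\<lambda>v. n \<le> v) p) = card (set (filter (\<lambda>v. n \<le> v) p))"
    using p(3) by (intro distinct_card[symmetric] distinct_filter)
  also have "\<dots> \<le> card {n..<n + s}"
    using p(1) by (intro card_mono) auto
  finally show ?thesis using hub_walk_length[OF p(2)] by simp
qed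

section \<open>Arbitrarily large dicritical digraphs\<close>

lemma large_dicritical_exists:
  assumes "2 \<le> s"
  shows "\<exists>D :: nat pair_pre_digraph. dicritical (Suc s) (with_proj D) \<and>
    (\<forall>p. vpath p (with_proj D) \<longrightarrow> length p \<le> 3 * s + 2) \<and> m \<le> card (pverts D)"
proof -
  define n where "n = 2 * Suc m"
  have n: "even n" "0 < n" "m \<le> n" by (auto simp: n_def)
  let ?G = "with_proj (hub_digraph s n)"
  obtain H where H: "subgraph H ?G" "dicritical (Suc s) H"
    using dicritical_subgraph_exists[OF digraph_hub_digraph[of s n]]
      dichromatic_number_hub_digraph[OF assms n(1,2)] by metis
  \<comment> \<open>A subgraph inherits \<open>fst\<close> and \<open>snd\<close> as tail and head,
    so \<open>H\<close> is itself a pair digraph.\<close>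
  define D where "D = \<lparr> pverts = verts H, parcs = arcs H \<rparr>"
  have HD: "H = with_proj D"
    using H(1) by (auto simp: D_def with_proj_def subgraph_def compatible_def intro: pre_digraph.equality)
  have sub: "pverts D \<subseteq> {..<n + s}" "parcs D \<subseteq> parcs (hub_digraph s n)"
    using H(1) unfolding HD by (auto simp: subgraph_def)
  \<comment> \<open>A missing path vertex would permit an \<open>s\<close>-dicolouring, so all
    \<open>n\<close> of them survive in \<open>H\<close>.\<close>
  have "w \<in> pverts D" if w: "w < n" for w
  proof (rule ccontr)
    assume "w \<notin> pverts D"
    then obtain c where "dicolouring H s c"
      using hub_digraph_subgraph_dicolouring[OF assms n(1) H(1) w] HD by (metis with_proj_simps(1))
    then have "dichromatic_number H \<le> s" by (rule dichromatic_number_le)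
    with H(2) show False by (simp add: dicritical_def)
  qed
  then have "card {..<n} \<le> card (pverts D)"
    using sub(1) by (intro card_mono) (auto intro: finite_subset)
  then show ?thesis
    using H(2) hub_digraph_vpath_length[OF _ sub] n(3) unfolding HD by auto
qed

lemma digraph_iso_card_verts_eq:
  assumes "digraph_iso G H"
  shows "card (verts G) = card (verts H)"
  using assms unfolding digraph_iso_def pre_digraph.digraph_isomorphism_def
  by (auto simp: card_image)

theorem theorem2:
  fixes k :: nat
  assumes "k \<ge> 3"
  shows "\<exists>S :: nat pair_pre_digraph set.
    infinite S \<and>
    (\<forall>D\<in>S. \<forall>D'\<in>S. D \<noteq> D' \<longrightarrow> \<not> digraph_iso (with_proj D) (with_proj D')) \<and>
    (\<forall>D\<in>S. dicritical k (with_proj D) \<and>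
            \<not> (\<exists>p. vpath p (with_proj D) \<and> length p = 3 * k + 1))"
proof -
  let ?card = "\<lambda>D :: nat pair_pre_digraph. card (pverts D)"
  define T :: "nat pair_pre_digraph set" where "T = {D. dicritical k (with_proj D) \<and>
    \<not> (\<exists>p. vpath p (with_proj D) \<and> length p = 3 * k + 1)}"
  have "\<exists>D\<in>T. m \<le> ?card D" for m
  proof -
    obtain D :: "nat pair_pre_digraph" where "dicritical (Suc (k - 1)) (with_proj D)"
      and len: "\<forall>p. vpath p (with_proj D) \<longrightarrow> length p \<le> 3 * (k - 1) + 2"
      and "m \<le> ?card D"
      using large_dicritical_exists[of "k - 1" m] assms by fastforce
    \<comment> \<open>The bound \<open>3 * (k - 1) + 2\<close> equals
      \<open>3 * k - 1\<close>.\<close>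
    moreover have "length p \<noteq> 3 * k + 1" if "vpath p (with_proj D)" for p
      using len that assms by fastforce
    ultimately show ?thesis using assms unfolding T_def by auto
  qed
  then have "infinite (?card ` T)"
    unfolding infinite_nat_iff_unbounded_le by blast
  \<comment> \<open>\<open>S\<close> keeps one member of \<open>T\<close> for each number of
    vertices that occurs; this number is invariant under isomorphism.\<close>
  moreover obtain S where S: "S \<subseteq> T" "?card ` S = ?card ` T" "inj_on ?card S"
    using subset_image_inj[of "?card ` T" ?card T] by auto
  ultimately have "infinite S" by (metis finite_imageI)
  moreover have "\<not> digraph_iso (with_proj D) (with_proj D')"
    if "D \<in> S" "D' \<in> S" "D \<noteq> D'" for D D'
    using digraph_iso_card_verts_eq[of "with_proj D" "with_proj D'"] inj_onD[OF S(3)] that by auto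
  ultimately show ?thesis
    using S(1) unfolding T_def by (intro exI[of _ S]) blast
qed

end
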